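(* Let $\sigma>0$, $\rho>0$ and let $N\ge 1$ be an integer. For $\mathbf b=(b_0,\ldots,b_{N-1})^T\in\mathbb C^N$ let $$F_\rho(\mathbf b)=\int_{-\infty}^{\infty}\Big|\,f^{(N)}(t)+\sum_{k=0}^{N-1}b_k f^{(k)}(t)\Big|^2\,\mathrm e^{-t^2/2\rho}\,\mathrm dt,\qquad f(t)=\mathrm e^{-t^2/2\sigma}.$$ Then the minimizing vector of the functional $F_\rho$ over $\mathbb C^N$ is $\mathbf b=(b_0,\ldots,b_{N-1})^T$ with $$b_k=\begin{cases}\dfrac{N!}{k!\,\big(\frac{N-k}{2}\big)!}\left(\dfrac{\rho+\sigma}{2\sigma(2\rho+\sigma)}\right)^{(N-k)/2}& N-k\ \text{even},\\[2mm] 0& N-k\ \text{odd}.\end{cases}$$ Moreover, for this $\mathbf b$ the corresponding characteristic polynomial $P_N(\lambda)=\lambda^N+\sum_{k=0}^{N-1}b_k\lambda^k$ satisfies $$P_N(\lambda)=\left(-\mathrm i\,\sqrt{\frac{\rho+\sigma}{2\sigma(2\rho+\sigma)}}\right)^{N}H_N\!\left(\mathrm i\,\sqrt{\frac{\sigma(2\rho+\sigma)}{2(\rho+\sigma)}}\;\lambda\right),$$ where $H_N$ is the physicist's Hermite polynomial of degree $N$.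
   Context: Here $f^{(k)}$ denotes the $k$-th derivative of $f$ (with $f^{(0)}=f$) and $\mathrm i$ is the imaginary unit. The physicist's Hermite polynomials are $H_n(t)=(-1)^n\mathrm e^{t^2}\frac{\mathrm d^n}{\mathrm dt^n}\mathrm e^{-t^2}$; they have leading coefficient $2^n$. *)

theory Defs
  imports "HOL-Probability.Distributions" "HOL-Computational_Algebra.Polynomial"
begin

text \<open>A vector of $\mathbb C^N$ with entries indexed by $0,\dots,N-1$ is an extensional function on
  \<open>{..<N}\<close>, so that equality of functions is equality of vectors.\<close>

definition cvecs :: "nat \<Rightarrow> (nat \<Rightarrow> complex) set" where
  "cvecs N = ({..<N} \<rightarrow>\<^sub>E UNIV)"

definition gauss :: "real \<Rightarrow> real \<Rightarrow> real" where
  "gauss \<sigma> t = exp (- t\<^sup>2 / (2 * \<sigma>))"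

definition residual :: "real \<Rightarrow> nat \<Rightarrow> (nat \<Rightarrow> complex) \<Rightarrow> real \<Rightarrow> complex" where
  "residual \<sigma> N b t =
     of_real ((deriv ^^ N) (gauss \<sigma>) t) + (\<Sum>k<N. b k * of_real ((deriv ^^ k) (gauss \<sigma>) t))"

text \<open>For \<open>\<sigma>, \<rho> > 0\<close> the integrand is a polynomial times a Gaussian, hence integrable
  (\<open>integrable_residual\<close> below), so the value is never the default 0 of a divergent integral.\<close>

definition F_rho :: "real \<Rightarrow> real \<Rightarrow> nat \<Rightarrow> (nat \<Rightarrow> complex) \<Rightarrow> real" where
  "F_rho \<sigma> \<rho> N b = (\<integral>t. (cmod (residual \<sigma> N b t))\<^sup>2 * exp (- t\<^sup>2 / (2 * \<rho>)) \<partial>lborel)"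

definition charac_poly :: "nat \<Rightarrow> (nat \<Rightarrow> complex) \<Rightarrow> complex poly" where
  "charac_poly N b = monom 1 N + (\<Sum>k<N. monom (b k) k)"

text \<open>Rodrigues' formula, at real or at complex arguments (with the real or the complex derivative).
  By \<open>hermite_poly\<close> below, both instances are given by one and the same real polynomial.\<close>

definition hermite :: "nat \<Rightarrow> 'a :: {real_normed_field, banach} \<Rightarrow> 'a" where
  "hermite n x = (-1) ^ n * exp (x\<^sup>2) * (deriv ^^ n) (\<lambda>t. exp (- t\<^sup>2)) x"

text \<open>The polynomial factor of the $n$-th derivative of $e^{-ct^2}$.\<close>

primrec rodrigues_poly :: "nat \<Rightarrow> 'a :: {real_normed_field, banach} \<Rightarrow> 'a poly" where
  "rodrigues_poly 0 c = 1"
| "rodrigues_poly (Suc n) c = pderiv (rodrigues_poly n c) - [:0, 2 * c:] * rodrigues_poly n c"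

lemma higher_deriv_gauss:
  fixes c :: "'a :: {real_normed_field, banach}"
  shows "(deriv ^^ n) (\<lambda>t. exp (- (c * t\<^sup>2))) = (\<lambda>t. poly (rodrigues_poly n c) t * exp (- (c * t\<^sup>2)))"
proof (induction n)
  case (Suc n)
  have "deriv (\<lambda>t. poly (rodrigues_poly n c) t * exp (- (c * t\<^sup>2))) x =
          poly (rodrigues_poly (Suc n) c) x * exp (- (c * x\<^sup>2))" for x
    by (rule DERIV_imp_deriv)
      (auto intro!: derivative_eq_intros poly_DERIV simp: algebra_simps power2_eq_square)
  then show ?case using Suc by auto
qed auto

lemma degree_rodrigues_poly:
  fixes c :: "'a :: {real_normed_field, banach}"
  assumes "c \<noteq> 0"
  shows "degree (rodrigues_poly n c) = n \<and> lead_coeff (rodrigues_poly n c) = (- 2 * c) ^ n"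
proof (induction n)
  case (Suc n)
  let ?p = "rodrigues_poly n c"
  have nz: "?p \<noteq> 0" using Suc assms by auto
  have 1: "degree ([:0, 2 * c:] * ?p) = Suc n"
    using nz assms Suc by (subst degree_mult_eq) auto
  have 2: "degree (pderiv ?p) < degree (- ([:0, 2 * c:] * ?p))"
    using 1 Suc nz assms degree_le[of n "pderiv ?p"] by (simp add: coeff_pderiv coeff_eq_0)
  have eq: "rodrigues_poly (Suc n) c = pderiv ?p + (- ([:0, 2 * c:] * ?p))" by simp
  have 3: "degree (rodrigues_poly (Suc n) c) = Suc n"
    unfolding eq using degree_add_eq_right[OF 2] 1 by (simp only: degree_minus)
  have 4: "lead_coeff (rodrigues_poly (Suc n) c) = lead_coeff (- ([:0, 2 * c:] * ?p))"
    unfolding eq by (rule lead_coeff_add_le[OF 2])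
  have "lead_coeff (- ([:0, 2 * c:] * ?p)) = (- 2 * c) * lead_coeff ?p"
    using assms by (simp only: lead_coeff_minus lead_coeff_mult) simp
  also have "\<dots> = (- 2 * c) ^ Suc n" by (subst Suc[THEN conjunct2]) simp
  finally show ?case using 3 4 by (simp only:)
qed auto

lemma hermite_eq_poly:
  fixes x :: "'a :: {real_normed_field, banach}"
  shows "hermite n x = poly (smult ((-1) ^ n) (rodrigues_poly n 1)) x"
proof -
  have "exp (x\<^sup>2) * (y * exp (- x\<^sup>2)) = y" for y
    by (simp add: exp_minus)
  then have "hermite n x = (-1) ^ n * poly (rodrigues_poly n 1) x"
    using higher_deriv_gauss[of n "1::'a"] by (simp only: hermite_def mult_1 mult.assoc)
  then show ?thesis by simp
qed

lemma map_poly_rodrigues: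
  "map_poly of_real (rodrigues_poly n (c::real)) =
     (rodrigues_poly n (of_real c) :: 'a :: {real_normed_field, banach} poly)"
proof (induction n)
  case (Suc n)
  have d: "map_poly of_real (p - q) = (map_poly of_real p - map_poly of_real q :: 'a poly)"
    for p q :: "real poly" by (intro poly_eqI) (simp add: coeff_map_poly)
  have m: "map_poly of_real (p * q) = (map_poly of_real p * map_poly of_real q :: 'a poly)"
    for p q :: "real poly" by (intro poly_eqI) (simp add: coeff_map_poly coeff_mult)
  have e: "map_poly of_real (pderiv p) = (pderiv (map_poly of_real p) :: 'a poly)"
    for p :: "real poly" by (intro poly_eqI) (simp add: coeff_map_poly coeff_pderiv)
  show ?case by (simp only: rodrigues_poly.simps d m e Suc) (simp add: map_poly_pCons)
qed auto

lemma hermite_poly: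
  "\<exists>p :: real poly. degree p = n \<and> lead_coeff p = 2 ^ n \<and>
     (\<forall>x. hermite n x = poly p x) \<and>
     (\<forall>z. hermite n z = poly (map_poly complex_of_real p) z)"
proof -
  let ?p = "smult ((-1) ^ n) (rodrigues_poly n (1::real))"
  have "map_poly complex_of_real ?p = smult ((-1) ^ n) (rodrigues_poly n 1)"
    using map_poly_rodrigues[of n 1, where 'a = complex]
    by (subst map_poly_smult) auto
  moreover have "lead_coeff ?p = 2 ^ n" "degree ?p = n"
    using degree_rodrigues_poly[of "1::real" n]
    by (auto simp flip: power_mult_distrib)
  ultimately show ?thesis by (intro exI[of _ ?p]) (auto simp: hermite_eq_poly)
qed

lemma integrable_poly_gauss:
  fixes a :: real assumes "a > 0"
  shows "integrable lborel (\<lambda>t. poly p t * exp (- (a * t\<^sup>2)))"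
proof -
  define s where "s = 1 / sqrt (2 * a)"
  have s: "s > 0" "s\<^sup>2 = 1 / (2 * a)"
    using assms by (auto simp: s_def power_divide)
  have "integrable lborel (\<lambda>t. t ^ k * exp (- (a * t\<^sup>2)))" for k
  proof -
    have "integrable lborel (\<lambda>t. sqrt (2 * pi * s\<^sup>2) * (normal_density 0 s t * (t - 0) ^ k))"
      by (intro integrable_mult_right integrable_normal_moment) (use s assms in auto)
    also have "(\<lambda>t. sqrt (2 * pi * s\<^sup>2) * (normal_density 0 s t * (t - 0) ^ k)) =
                 (\<lambda>t. t ^ k * exp (- (a * t\<^sup>2)))"
    proof
      fix t :: real
      have "sqrt (2 * pi * s\<^sup>2) \<noteq> 0" using s(1) by simp
      moreover have "- (t - 0)\<^sup>2 / (2 * s\<^sup>2) = - (a * t\<^sup>2)" using assms s by (simp add: field_simps)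
      ultimately show "sqrt (2 * pi * s\<^sup>2) * (normal_density 0 s t * (t - 0) ^ k) =
                         t ^ k * exp (- (a * t\<^sup>2))"
        unfolding normal_density_def by (simp only:) simp
    qed
    finally show ?thesis .
  qed
  then have "integrable lborel
               (\<lambda>t. \<Sum>k\<le>degree p. coeff p k * (t ^ k * exp (- (a * t\<^sup>2))))"
    by (intro Bochner_Integration.integrable_sum integrable_mult_right) auto
  then show ?thesis by (simp add: poly_altdef sum_distrib_right mult.assoc)
qed

lemma integrable_residual:
  assumes "\<sigma> > 0" "\<rho> > 0"
  shows "integrable lborel (\<lambda>t. (cmod (residual \<sigma> N b t))\<^sup>2 * exp (- t\<^sup>2 / (2 * \<rho>)))"
proof -
  define c where "c = 1 / (2 * \<sigma>)"
  define d where "d = 1 / (2 * \<rho>)"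
  define R where "R = rodrigues_poly N c + (\<Sum>k<N. smult (Re (b k)) (rodrigues_poly k c))"
  define I where "I = (\<Sum>k<N. smult (Im (b k)) (rodrigues_poly k c))"
  have g: "(deriv ^^ k) (gauss \<sigma>) t = poly (rodrigues_poly k c) t * exp (- (c * t\<^sup>2))" for k t
    using higher_deriv_gauss[of k c] by (simp add: gauss_def[abs_def] c_def)
  have re: "Re (residual \<sigma> N b t) = poly R t * exp (- (c * t\<^sup>2))" for t
    by (simp add: residual_def g R_def poly_sum sum_distrib_left algebra_simps)
  have im: "Im (residual \<sigma> N b t) = poly I t * exp (- (c * t\<^sup>2))" for t
    by (simp add: residual_def g I_def poly_sum sum_distrib_left algebra_simps)
  have "(cmod (residual \<sigma> N b t))\<^sup>2 * exp (- t\<^sup>2 / (2 * \<rho>)) =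
          poly (R\<^sup>2 + I\<^sup>2) t * exp (- ((2 * c + d) * t\<^sup>2))" for t
  proof -
    have "exp (- ((2 * c + d) * t\<^sup>2)) = (exp (- (c * t\<^sup>2)))\<^sup>2 * exp (- t\<^sup>2 / (2 * \<rho>))"
      by (simp add: d_def algebra_simps flip: exp_add exp_double)
    then show ?thesis
      by (simp only: cmod_power2 re im poly_add poly_power power_mult_distrib) (simp add: algebra_simps)
  qed
  moreover have "2 * c + d > 0" using assms by (simp add: c_def d_def add_pos_pos)
  ultimately show ?thesis using integrable_poly_gauss[of "2 * c + d" "R\<^sup>2 + I\<^sup>2"] by simp
qed

end

theory Submission
  imports Defs "HOL-Computational_Algebra.Formal_Power_Series" "HOL-Real_Asymp.Real_Asymp"
begin

unbundle no vec_syntax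
unbundle fps_syntax

text \<open>Write \<open>c = 1/(2\<sigma>)\<close> and \<open>a = 1/\<sigma> + 1/(2\<rho>)\<close>. The residual is a polynomial of degree \<open>N\<close> with
  leading coefficient \<open>(-2c)^N\<close> times \<open>exp (-c t\<^sup>2)\<close>, and its lower-order part runs through all polynomials
  of degree less than \<open>N\<close>; so the minimum is attained exactly at the multiple
  \<open>(c/a)^N\<close> of the Rodrigues polynomial for the weight \<open>exp (-a t\<^sup>2)\<close>, which is orthogonal
  to lower degrees. All polynomials involved have exponential generating functions of the form
  \<open>exp (u X + v X\<^sup>2)\<close>, and comparing these expresses the minimizer in the given coefficients and
  identifies the characteristic polynomial, whose generating function is \<open>exp (\<lambda> X + \<kappa> X\<^sup>2)\<close>
  with \<open>\<kappa> = c (1 - c/a)\<close>.\<close>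

section \<open>Generating functions\<close>

definition fps_exp_sq :: "'a :: field_char_0 \<Rightarrow> 'a fps" where
  "fps_exp_sq v = fps_exp v oo fps_X\<^sup>2"

text \<open>Only even powers of \<open>fps_X\<close> occur; this is the source of the parity split
  in the coefficients \<open>b k\<close>.\<close>

lemma fps_exp_sq_nth:
  "fps_exp_sq v $ n = (if even n then v ^ (n div 2) / fact (n div 2) else 0)"
proof -
  have "fps_exp_sq v $ n = (\<Sum>i=0..n. if n = 2 * i then v ^ i / fact i else 0)"
    unfolding fps_exp_sq_def fps_compose_nth
    by (intro sum.cong refl) (simp flip: power_mult)
  also have "\<dots> = (\<Sum>i=0..n. if i = n div 2 then (if even n then v ^ i / fact i else 0) else 0)"
    by (intro sum.cong refl) auto
  also have "\<dots> = (if even n then v ^ (n div 2) / fact (n div 2) else 0)"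
    by (subst sum.delta) auto
  finally show ?thesis .
qed

lemma fps_exp_sq_add: "fps_exp_sq (v + w) = fps_exp_sq v * fps_exp_sq w"
  unfolding fps_exp_sq_def fps_exp_add_mult by (rule fps_compose_mult_distrib) simp

lemma fps_deriv_exp_sq: "fps_deriv (fps_exp_sq v) = fps_const (2 * v) * fps_X * fps_exp_sq v"
proof -
  have "fps_deriv (fps_exp_sq v) = ((fps_const v * fps_exp v) oo fps_X\<^sup>2) * fps_deriv (fps_X\<^sup>2)"
    unfolding fps_exp_sq_def by (subst fps_compose_deriv) auto
  also have "(fps_const v * fps_exp v) oo fps_X\<^sup>2 = fps_const v * fps_exp_sq v"
    unfolding fps_exp_sq_def by (subst fps_compose_mult_distrib) auto
  also have "fps_deriv (fps_X\<^sup>2 :: 'a fps) = fps_const 2 * fps_X"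
    by (simp add: power2_eq_square fps_deriv_mult flip: numeral_fps_const)
  finally show ?thesis by (simp add: algebra_simps flip: fps_const_mult)
qed

text \<open>The two-variable Hermite (Kampe de Feriet) polynomials, with exponential generating
  function exp(u X + v X^2); the physicist's H_n(x) is
  \<open>hermite2 n (2 * x) (- 1)\<close>.\<close>

definition hermite2 :: "nat \<Rightarrow> 'a :: field_char_0 \<Rightarrow> 'a \<Rightarrow> 'a" where
  "hermite2 n u v = fact n * (fps_exp u * fps_exp_sq v) $ n"

text \<open>Multiplying the generating function by exp(w X^2) shifts \<open>v\<close> by
  \<open>w\<close>; the Cauchy product gives the sum. For w = \<kappa> its weights are the
  coefficients of the minimizer.\<close>

lemma hermite2_add:
  "hermite2 n u (v + w) = (\<Sum>k\<le>n. fact n / fact k * fps_exp_sq w $ (n - k) * hermite2 k u v)"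
proof -
  have "hermite2 n u (v + w) = fact n * ((fps_exp u * fps_exp_sq v) * fps_exp_sq w) $ n"
    by (simp add: hermite2_def fps_exp_sq_add mult.assoc)
  also have "\<dots> = (\<Sum>k\<le>n. fact n * ((fps_exp u * fps_exp_sq v) $ k * fps_exp_sq w $ (n - k)))"
    by (subst fps_mult_nth) (simp add: sum_distrib_left atLeast0AtMost)
  also have "\<dots> = (\<Sum>k\<le>n. fact n / fact k * fps_exp_sq w $ (n - k) * hermite2 k u v)"
    by (intro sum.cong refl) (simp add: hermite2_def)
  finally show ?thesis .
qed

text \<open>This is the substitution of r X for X in exp(u X + v X^2).\<close>

lemma hermite2_scale: "hermite2 n (r * u) (r\<^sup>2 * v) = r ^ n * hermite2 n u v"
proof -
  have e: "r ^ k * r ^ (n - k) = r ^ n" if "k \<le> n" for k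
    using that by (simp flip: power_add)
  have "fps_exp (r * u) $ k * fps_exp_sq (r\<^sup>2 * v) $ (n - k) =
          r ^ n * (fps_exp u $ k * fps_exp_sq v $ (n - k))" if "k \<le> n" for k
  proof (cases "even (n - k)")
    case True
    then have "(r\<^sup>2) ^ ((n - k) div 2) = r ^ (n - k)"
      by (simp flip: power_mult)
    then show ?thesis using True e[OF that, symmetric]
      by (simp add: fps_exp_sq_nth power_mult_distrib)
  qed (simp add: fps_exp_sq_nth)
  then show ?thesis
    by (simp add: hermite2_def fps_mult_nth sum_distrib_left mult.left_commute)
qed

lemma hermite2_0: "hermite2 0 u v = 1"
  by (simp add: hermite2_def fps_exp_sq_nth)

lemma hermite2_1: "hermite2 (Suc 0) u v = u"
  by (simp add: hermite2_def fps_exp_sq_nth fps_mult_nth)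

text \<open>The generating function G satisfies G' = (u + 2 v X) G; compare coefficients of
  X^(n+1).\<close>

lemma hermite2_Suc_Suc:
  "hermite2 (Suc (Suc n)) u v = u * hermite2 (Suc n) u v + 2 * v * of_nat (Suc n) * hermite2 n u v"
proof -
  let ?G = "fps_exp u * fps_exp_sq v"
  have "fps_deriv ?G = fps_const u * ?G + fps_const (2 * v) * (fps_X * ?G)"
    by (simp add: fps_deriv_exp_sq algebra_simps)
  from arg_cong[OF this, of "\<lambda>f. f $ Suc n"]
  have "of_nat (Suc (Suc n)) * ?G $ Suc (Suc n) = u * ?G $ Suc n + 2 * v * ?G $ n"
    by (simp only: fps_add_nth fps_deriv_nth fps_mult_left_const_nth fps_X_mult_nth Suc_eq_plus1)
      (simp del: of_nat_Suc)
  then have "fact (Suc n) * (of_nat (Suc (Suc n)) * ?G $ Suc (Suc n)) =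
               fact (Suc n) * (u * ?G $ Suc n + 2 * v * ?G $ n)"
    by simp
  moreover have "fact (Suc (Suc n)) = fact (Suc n) * (of_nat (Suc (Suc n)) :: 'a)"
    "fact (Suc n) = fact n * (of_nat (Suc n) :: 'a)"
    by (metis fact_Suc mult.commute)+
  ultimately show ?thesis
    by (simp only: hermite2_def) (simp add: algebra_simps del: of_nat_Suc fact_Suc)
qed

text \<open>Removes the derivative from the defining recurrence, leaving a three-term recurrence
  comparable with \<open>hermite2_Suc_Suc\<close>.\<close>

lemma pderiv_rodrigues_poly:
  "pderiv (rodrigues_poly (Suc n) c) = smult (- 2 * c * of_nat (Suc n)) (rodrigues_poly n c)"
proof (induction n)
  case (Suc n)
  let ?R = "\<lambda>k. rodrigues_poly k c" and ?x = "[:0, 2 * c:]"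
  have "pderiv (?R (Suc (Suc n))) =
          pderiv (pderiv (?R (Suc n))) - (?x * pderiv (?R (Suc n)) + smult (2 * c) (?R (Suc n)))"
    by (subst rodrigues_poly.simps(2))
      (simp add: pderiv_diff pderiv_mult pderiv_pCons pderiv_smult del: rodrigues_poly.simps(2))
  also have "\<dots> = smult (- 2 * c * of_nat (Suc n)) (pderiv (?R n) - ?x * ?R n) - smult (2 * c) (?R (Suc n))"
    unfolding Suc pderiv_smult by (simp add: smult_diff_right)
  also have "pderiv (?R n) - ?x * ?R n = ?R (Suc n)" by simp
  finally show ?case
    by (simp only: flip: smult_diff_left) (simp add: algebra_simps)
qed (simp add: pderiv_pCons)

text \<open>Both sides share recurrence and initial values. Behind it is the Taylor expansion of
  exp(-c (x + X)^2) / exp(-c x^2) = exp(-2 c x X - c X^2).\<close>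

lemma rodrigues_poly_eq_hermite2:
  "poly (rodrigues_poly n c) x = hermite2 n (- 2 * c * x) (- c)"
proof (induction n rule: induct_nat_012)
  case (ge2 n)
  have "poly (rodrigues_poly (Suc (Suc n)) c) x =
    poly (pderiv (rodrigues_poly (Suc n) c)) x - 2 * c * x * poly (rodrigues_poly (Suc n) c) x"
    by (subst rodrigues_poly.simps) (simp del: rodrigues_poly.simps)
  also have "\<dots> = hermite2 (Suc (Suc n)) (- 2 * c * x) (- c)"
    unfolding pderiv_rodrigues_poly hermite2_Suc_Suc using ge2 by (simp del: rodrigues_poly.simps)
  finally show ?case .
qed (simp_all add: hermite2_0 hermite2_1)

section \<open>Orthogonality with respect to a Gaussian weight\<close>

lemma poly_gauss_tendsto_0:
  fixes a :: real assumes "a > 0"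
  shows "((\<lambda>t. poly p t * exp (- (a * t\<^sup>2))) \<longlongrightarrow> 0) at_top"
    and "((\<lambda>t. poly p t * exp (- (a * t\<^sup>2))) \<longlongrightarrow> 0) at_bot"
proof -
  have top: "((\<lambda>t. poly p t * exp (- (a * t\<^sup>2))) \<longlongrightarrow> 0) at_top" for p :: "real poly"
  proof -
    have "((\<lambda>t. coeff p k * (t ^ k * exp (- (a * t\<^sup>2)))) \<longlongrightarrow> 0) at_top" for k
    proof -
      have "((\<lambda>t. t ^ k * exp (- (a * t\<^sup>2))) \<longlongrightarrow> 0) at_top"
        using assms by real_asymp
      then show ?thesis by (rule tendsto_mult_right_zero)
    qed
    then have "((\<lambda>t. \<Sum>k\<le>degree p. coeff p k * (t ^ k * exp (- (a * t\<^sup>2)))) \<longlongrightarrow> 0) at_top"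
      by (rule tendsto_null_sum)
    then show ?thesis by (simp add: poly_altdef sum_distrib_right mult.assoc)
  qed
  show "((\<lambda>t. poly p t * exp (- (a * t\<^sup>2))) \<longlongrightarrow> 0) at_top" by (rule top)
  \<comment> \<open>The weight is even, so reflecting the polynomial reduces this end to the
    other.\<close>
  show "((\<lambda>t. poly p t * exp (- (a * t\<^sup>2))) \<longlongrightarrow> 0) at_bot"
    using top[of "p \<circ>\<^sub>p [:0, -1:]"] by (simp add: filterlim_at_bot_mirror poly_pcompose)
qed

text \<open>The integrand is the derivative of p(t) exp(-a t^2), which vanishes at both
  ends.\<close>

lemma integral_deriv_poly_gauss:
  fixes a :: real assumes "a > 0"
  shows "(\<integral>t. poly (pderiv p - [:0, 2 * a:] * p) t * exp (- (a * t\<^sup>2)) \<partial>lborel) = 0"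
proof -
  let ?f = "\<lambda>t. poly (pderiv p - [:0, 2 * a:] * p) t * exp (- (a * t\<^sup>2))"
  have "(LBINT t=-\<infinity>..\<infinity>. ?f t) = 0 - 0"
  proof (rule interval_integral_FTC_integrable)
    fix x :: real
    show "((\<lambda>t. poly p t * exp (- (a * t\<^sup>2))) has_vector_derivative ?f x) (at x)"
      unfolding has_real_derivative_iff_has_vector_derivative[symmetric]
      by (auto intro!: derivative_eq_intros poly_DERIV simp: algebra_simps power2_eq_square)
    show "isCont ?f x" by (intro continuous_intros)
  next
    show "set_integrable lborel (einterval (- \<infinity>) \<infinity>) ?f"
      using integrable_poly_gauss[OF assms, of "pderiv p - [:0, 2 * a:] * p"]
      by (simp only: set_integrable_def einterval_eq indicator_UNIV scaleR_one)
  qed (use poly_gauss_tendsto_0[OF assms] in \<open>simp_all add: ereal_tendsto_simps\<close>)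
  then show ?thesis
    by (simp only: interval_lebesgue_integral_def set_lebesgue_integral_def einterval_eq indicator_UNIV scaleR_one)
      simp
qed

text \<open>Integration by parts: the recurrence moves one derivative at a time from the weight to
  \<open>q\<close>, whose degree drops until it vanishes. The disjunct \<open>q = 0\<close> is the
  base case, since the zero polynomial has degree 0.\<close>

lemma rodrigues_poly_orthogonal:
  fixes a :: real assumes "a > 0"
  shows "q = 0 \<or> degree q < n \<Longrightarrow>
    (\<integral>t. poly (rodrigues_poly n a * q) t * exp (- (a * t\<^sup>2)) \<partial>lborel) = 0"
proof (induction n arbitrary: q)
  case (Suc n)
  let ?R = "rodrigues_poly n a" and ?w = "\<lambda>t. exp (- (a * t\<^sup>2))"
  let ?d = "pderiv (?R * q) - [:0, 2 * a:] * (?R * q)"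
  have "rodrigues_poly (Suc n) a * q = ?d - ?R * pderiv q"
    by (simp add: pderiv_mult algebra_simps)
  then have "(\<integral>t. poly (rodrigues_poly (Suc n) a * q) t * ?w t \<partial>lborel) =
    (\<integral>t. poly ?d t * ?w t - poly (?R * pderiv q) t * ?w t \<partial>lborel)"
    by (simp only: poly_diff left_diff_distrib)
  also have "\<dots> = (\<integral>t. poly ?d t * ?w t \<partial>lborel) - (\<integral>t. poly (?R * pderiv q) t * ?w t \<partial>lborel)"
    by (intro Bochner_Integration.integral_diff integrable_poly_gauss assms)
  also have "\<dots> = 0"
  proof -
    have "pderiv q = 0 \<or> degree (pderiv q) < n"
      using Suc.prems by (cases "degree q = 0") (auto simp: degree_pderiv pderiv_eq_0_iff)
    then show ?thesis using Suc.IH integral_deriv_poly_gauss[OF assms] by (simp only: diff_0_right)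
  qed
  finally show ?case .
qed simp

text \<open>A zero integral would force \<open>p\<close> to vanish almost everywhere, but its roots
  form a finite, hence null, set.\<close>

lemma integral_square_gauss_pos:
  fixes a :: real assumes "a > 0" "p \<noteq> 0"
  shows "(\<integral>t. poly (p\<^sup>2) t * exp (- (a * t\<^sup>2)) \<partial>lborel) > 0"
proof -
  let ?f = "\<lambda>t. poly (p\<^sup>2) t * exp (- (a * t\<^sup>2))"
  have int: "integrable lborel ?f" by (rule integrable_poly_gauss[OF assms(1)])
  have nn: "AE t in lborel. 0 \<le> ?f t" by simp
  have "integral\<^sup>L lborel ?f \<noteq> 0"
  proof
    assume "integral\<^sup>L lborel ?f = 0"
    then have "AE t in lborel. ?f t = 0"
      using integral_nonneg_eq_0_iff_AE[OF int nn] by simp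
    moreover have "AE t in lborel. t \<notin> {t. poly p t = 0}"
      by (intro AE_not_in finite_imp_null_set_lborel poly_roots_finite assms)
    ultimately have "AE t in (lborel :: real measure). False" by eventually_elim simp
    then show False by (simp add: eventually_False ae_filter_eq_bot_iff)
  qed
  moreover have "integral\<^sup>L lborel ?f \<ge> 0" by (intro integral_nonneg_AE nn)
  ultimately show ?thesis by (metis order_less_le)
qed

section \<open>The minimizer\<close>

text \<open>Linear independence by distinct degrees: the top coefficient of the sum comes from its
  last term alone. Uniqueness of the minimizer rests on this.\<close>

lemma sum_smult_eq_0_iff:
  fixes R :: "nat \<Rightarrow> 'a :: idom poly"
  assumes "\<And>k. degree (R k) = k" "\<And>k. R k \<noteq> 0"
  shows "(\<Sum>k<n. smult (x k) (R k)) = 0 \<longleftrightarrow> (\<forall>k<n. x k = 0)"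
proof (induction n)
  case (Suc n)
  have "x n = 0" if "(\<Sum>k<Suc n. smult (x k) (R k)) = 0"
  proof -
    have "coeff (\<Sum>k<Suc n. smult (x k) (R k)) n = x n * lead_coeff (R n)"
      using assms(1) by (simp add: coeff_sum coeff_eq_0)
    then have "x n * lead_coeff (R n) = 0" unfolding that by simp
    then show ?thesis using assms(2)[of n] by simp
  qed
  then show ?case using Suc by (auto simp: less_Suc_eq)
qed simp

lemma degree_sum_smult_less:
  assumes "\<And>k. degree (R k) = k"
  shows "(\<Sum>k<n. smult (x k) (R k)) = 0 \<or> degree (\<Sum>k<n. smult (x k) (R k)) < n"
proof (cases n)
  case (Suc m)
  have "degree (\<Sum>k<n. smult (x k) (R k)) \<le> m"
    using assms Suc by (intro degree_sum_le) (auto intro: order.trans[OF degree_smult_le])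
  then show ?thesis using Suc by simp
qed simp

text \<open>The Rodrigues polynomials are real, so the real and imaginary parts of \<open>b\<close>
  separate; the squared factor exp(-c t^2) and the weight combine because a = 2 c + 1/(2
  \<rho>).\<close>

lemma F_rho_eq:
  assumes "\<sigma> > 0" "\<rho> > 0"
  defines "c \<equiv> 1 / (2 * \<sigma>)" and "a \<equiv> 1 / \<sigma> + 1 / (2 * \<rho>)"
  shows "F_rho \<sigma> \<rho> N b = (\<integral>t. poly
    ((rodrigues_poly N c + (\<Sum>k<N. smult (Re (b k)) (rodrigues_poly k c)))\<^sup>2 +
     (\<Sum>k<N. smult (Im (b k)) (rodrigues_poly k c))\<^sup>2) t * exp (- (a * t\<^sup>2)) \<partial>lborel)"
proof -
  define A where "A = rodrigues_poly N c + (\<Sum>k<N. smult (Re (b k)) (rodrigues_poly k c))"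
  define B where "B = (\<Sum>k<N. smult (Im (b k)) (rodrigues_poly k c))"
  have g: "(deriv ^^ k) (gauss \<sigma>) t = poly (rodrigues_poly k c) t * exp (- (c * t\<^sup>2))" for k t
    using higher_deriv_gauss[of k c] by (simp add: gauss_def[abs_def] c_def)
  have re: "Re (residual \<sigma> N b t) = poly A t * exp (- (c * t\<^sup>2))" for t
    by (simp add: residual_def g A_def poly_sum sum_distrib_left algebra_simps)
  have im: "Im (residual \<sigma> N b t) = poly B t * exp (- (c * t\<^sup>2))" for t
    by (simp add: residual_def g B_def poly_sum sum_distrib_left algebra_simps)
  have "(cmod (residual \<sigma> N b t))\<^sup>2 * exp (- t\<^sup>2 / (2 * \<rho>)) =
          poly (A\<^sup>2 + B\<^sup>2) t * exp (- (a * t\<^sup>2))" for t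
  proof -
    have "exp (- (a * t\<^sup>2)) = (exp (- (c * t\<^sup>2)))\<^sup>2 * exp (- t\<^sup>2 / (2 * \<rho>))"
      using assms(1,2) by (simp add: c_def a_def field_simps flip: exp_add exp_double)
    then show ?thesis
      by (simp only: cmod_power2 re im poly_add poly_power power_mult_distrib) (simp add: algebra_simps)
  qed
  then show ?thesis by (simp add: F_rho_def A_def B_def)
qed

text \<open>Pythagoras: changing \<open>b\<close> adds a polynomial of lower degree, orthogonal to
  \<open>S\<close>, to the real part, so the cost grows by the squared norms of the changes in both
  parts.\<close>

lemma is_arg_min_F_rho:
  assumes "\<sigma> > 0" "\<rho> > 0"
  defines "c \<equiv> 1 / (2 * \<sigma>)" and "a \<equiv> 1 / \<sigma> + 1 / (2 * \<rho>)"
  assumes b: "b \<in> cvecs N" "\<And>k. k < N \<Longrightarrow> Im (b k) = 0"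
    and S: "rodrigues_poly N c + (\<Sum>k<N. smult (Re (b k)) (rodrigues_poly k c)) = S"
    and orth: "\<And>q. q = 0 \<or> degree q < N \<Longrightarrow>
      (\<integral>t. poly (S * q) t * exp (- (a * t\<^sup>2)) \<partial>lborel) = 0"
  shows "is_arg_min (F_rho \<sigma> \<rho> N) (\<lambda>x. x \<in> cvecs N) x \<longleftrightarrow> x = b"
proof -
  have c: "c > 0" and a: "a > 0" using assms(1,2) by (auto simp: c_def a_def add_pos_pos)
  let ?R = "\<lambda>k. rodrigues_poly k c"
  define J where "J = (\<lambda>p. \<integral>t. poly p t * exp (- (a * t\<^sup>2)) \<partial>lborel)"
  have deg: "degree (?R k) = k" "?R k \<noteq> 0" for k
    using degree_rodrigues_poly[of c k] c by auto
  have J_add: "J (p + q) = J p + J q" for p q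
    unfolding J_def poly_add distrib_right
    by (intro Bochner_Integration.integral_add integrable_poly_gauss a)
  have J_sq: "J (p\<^sup>2) \<ge> 0" "p \<noteq> 0 \<Longrightarrow> J (p\<^sup>2) > 0" for p
    using integral_square_gauss_pos[OF a, of p]
    by (cases "p = 0"; simp add: J_def less_imp_le)+
  have F: "F_rho \<sigma> \<rho> N y = J ((?R N + (\<Sum>k<N. smult (Re (y k)) (?R k)))\<^sup>2 +
             (\<Sum>k<N. smult (Im (y k)) (?R k))\<^sup>2)" for y
    unfolding J_def c_def a_def by (rule F_rho_eq[OF assms(1,2)])
  have Im_b: "(\<Sum>k<N. smult (Im (b k)) (?R k)) = 0"
    using b(2) by (intro sum.neutral) auto
  have Fb: "F_rho \<sigma> \<rho> N b = J (S\<^sup>2)"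
    by (simp add: F S Im_b)
  have less: "F_rho \<sigma> \<rho> N b < F_rho \<sigma> \<rho> N y" if "y \<in> cvecs N" "y \<noteq> b" for y
  proof -
    define p where "p = (\<Sum>k<N. smult (Re (y k) - Re (b k)) (?R k))"
    define q where "q = (\<Sum>k<N. smult (Im (y k)) (?R k))"
    have "(\<Sum>k<N. smult (Re (y k)) (?R k)) = (\<Sum>k<N. smult (Re (b k)) (?R k)) + p"
      by (simp add: p_def sum.distrib smult_diff_left sum_subtractf)
    then have "F_rho \<sigma> \<rho> N y = J ((S + p)\<^sup>2 + q\<^sup>2)"
      by (simp add: F q_def add.assoc flip: S)
    \<comment> \<open>The cross term is written twice so that additivity of \<open>J\<close>
      suffices to split the integral.\<close>
    also have "(S + p)\<^sup>2 + q\<^sup>2 = S\<^sup>2 + S * p + S * p + p\<^sup>2 + q\<^sup>2"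
      by (simp add: power2_eq_square algebra_simps)
    also have "J \<dots> = J (S\<^sup>2) + J (p\<^sup>2) + J (q\<^sup>2)"
    proof -
      have "J (S * p) = 0"
        unfolding J_def p_def by (intro orth degree_sum_smult_less deg(1))
      then show ?thesis by (simp only: J_add)
    qed
    finally have Fy: "F_rho \<sigma> \<rho> N y = J (S\<^sup>2) + J (p\<^sup>2) + J (q\<^sup>2)" .
    have "p \<noteq> 0 \<or> q \<noteq> 0"
    proof (rule ccontr)
      assume "\<not> ?thesis"
      then have "Re (y k) - Re (b k) = 0" "Im (y k) = 0" if "k < N" for k
        using that sum_smult_eq_0_iff[of ?R, OF deg] by (auto simp: p_def q_def)
      then have "y k = b k" if "k < N" for k
        using that b(2) by (simp add: complex_eq_iff)
      \<comment> \<open>Both vectors are extensional, so agreement below \<open>N\<close> gives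
        equality.\<close>
      then have "y = b"
        using \<open>y \<in> cvecs N\<close> b(1) by (auto simp: cvecs_def intro: PiE_ext)
      then show False using that by simp
    qed
    then show ?thesis using J_sq(1)[of p] J_sq(1)[of q] J_sq(2)[of p] J_sq(2)[of q] Fb Fy by auto
  qed
  show ?thesis
  proof
    assume "is_arg_min (F_rho \<sigma> \<rho> N) (\<lambda>x. x \<in> cvecs N) x"
    then show "x = b" using less b(1) by (auto simp: is_arg_min_def)
  next
    assume "x = b"
    then show "is_arg_min (F_rho \<sigma> \<rho> N) (\<lambda>x. x \<in> cvecs N) x"
      using less b(1) by (fastforce simp: is_arg_min_def)
  qed
qed

theorem theorem2p1:
  fixes \<sigma> \<rho> :: real and N :: nat and b :: "nat \<Rightarrow> complex"
  assumes "\<sigma> > 0" and "\<rho> > 0" and "N \<ge> 1"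
    and b_eq: "b = (\<lambda>k\<in>{..<N}.
      if even (N - k)
      then of_real (fact N / (fact k * fact ((N - k) div 2)) *
             ((\<rho> + \<sigma>) / (2 * \<sigma> * (2 * \<rho> + \<sigma>))) ^ ((N - k) div 2))
      else 0)"
  shows "(\<forall>c. is_arg_min (F_rho \<sigma> \<rho> N) (\<lambda>c. c \<in> cvecs N) c \<longleftrightarrow> c = b) \<and>
    (\<forall>z :: complex. poly (charac_poly N b) z =
       (- \<i> * of_real (sqrt ((\<rho> + \<sigma>) / (2 * \<sigma> * (2 * \<rho> + \<sigma>))))) ^ N *
       hermite N (\<i> * of_real (sqrt (\<sigma> * (2 * \<rho> + \<sigma>) / (2 * (\<rho> + \<sigma>)))) * z))"
proof -
  define c where "c = 1 / (2 * \<sigma>)"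
  define a where "a = 1 / \<sigma> + 1 / (2 * \<rho>)"
  define \<kappa> where "\<kappa> = (\<rho> + \<sigma>) / (2 * \<sigma> * (2 * \<rho> + \<sigma>))"
  have pos: "c > 0" "a > 0" "\<kappa> > 0"
    using assms(1,2) by (auto simp: c_def a_def \<kappa>_def add_pos_pos)
  \<comment> \<open>\<open>\<beta>\<close> extends the coefficients to k = N with value 1, absorbing
    the leading term into the sum.\<close>
  define \<beta> where "\<beta> k = fact N / fact k * fps_exp_sq \<kappa> $ (N - k)" for k
  have \<beta>_N: "\<beta> N = 1" by (simp add: \<beta>_def fps_exp_sq_nth)
  have b_\<beta>: "b k = of_real (\<beta> k)" if "k < N" for k
    using that by (simp add: b_eq \<beta>_def \<kappa>_def fps_exp_sq_nth)
  have "is_arg_min (F_rho \<sigma> \<rho> N) (\<lambda>c. c \<in> cvecs N) x \<longleftrightarrow> x = b" for x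
  proof (rule is_arg_min_F_rho[OF assms(1,2)])
    show "b \<in> cvecs N" by (simp add: b_eq cvecs_def)
    show "Im (b k) = 0" if "k < N" for k using b_\<beta>[OF that] by simp
    \<comment> \<open>The factor matches the leading coefficients (-2c)^N and (-2a)^N.\<close>
    let ?S = "smult ((c / a) ^ N) (rodrigues_poly N a)"
    \<comment> \<open>Here c/a = \<rho>/(2\<rho> + \<sigma>), so \<kappa> = c - c^2/a: adding
      \<kappa> to -c yields the parameter -a rescaled by c/a.\<close>
    have scale: "\<kappa> - c = (c / a)\<^sup>2 * (- a)"
    proof -
      have "a = (2 * \<rho> + \<sigma>) / (2 * \<rho> * \<sigma>)"
        using assms(1,2) by (simp add: a_def field_simps)
      moreover have "2 * \<rho> + \<sigma> > 0" using assms(1,2) by simp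
      ultimately show ?thesis
        using assms(1,2) pos(2)
        by (simp add: c_def \<kappa>_def power2_eq_square divide_simps) (simp add: algebra_simps)
    qed
    have "rodrigues_poly N c + (\<Sum>k<N. smult (Re (b k)) (rodrigues_poly k c)) = ?S"
      unfolding poly_eq_poly_eq_iff[symmetric]
    proof
      fix t
      have "poly (rodrigues_poly N c + (\<Sum>k<N. smult (Re (b k)) (rodrigues_poly k c))) t =
              (\<Sum>k\<le>N. \<beta> k * poly (rodrigues_poly k c) t)"
        by (simp add: poly_sum b_\<beta> \<beta>_N flip: lessThan_Suc_atMost)
      also have "\<dots> = hermite2 N (- 2 * c * t) (- c + \<kappa>)"
        by (simp only: hermite2_add rodrigues_poly_eq_hermite2 \<beta>_def)
      also have "\<dots> = hermite2 N (c / a * (- 2 * a * t)) ((c / a)\<^sup>2 * (- a))"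
      proof -
        have "- 2 * c * t = c / a * (- 2 * a * t)" using pos by simp
        moreover have "- c + \<kappa> = (c / a)\<^sup>2 * (- a)" using scale by simp
        ultimately show ?thesis by (simp only:)
      qed
      also have "\<dots> = poly ?S t"
        by (simp only: hermite2_scale poly_smult rodrigues_poly_eq_hermite2)
      finally show "poly (rodrigues_poly N c + (\<Sum>k<N. smult (Re (b k)) (rodrigues_poly k c))) t =
                      poly ?S t" .
    qed
    then show "rodrigues_poly N (1 / (2 * \<sigma>)) +
        (\<Sum>k<N. smult (Re (b k)) (rodrigues_poly k (1 / (2 * \<sigma>)))) = ?S"
      by (simp only: c_def)
    show "(\<integral>t. poly (?S * q) t * exp (- ((1 / \<sigma> + 1 / (2 * \<rho>)) * t\<^sup>2)) \<partial>lborel) = 0"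
      if "q = 0 \<or> degree q < N" for q
      using rodrigues_poly_orthogonal[OF pos(2) that]
      by (simp add: mult.assoc flip: a_def)
  qed
  moreover have "poly (charac_poly N b) z =
       (- \<i> * of_real (sqrt \<kappa>)) ^ N *
       hermite N (\<i> * of_real (sqrt (\<sigma> * (2 * \<rho> + \<sigma>) / (2 * (\<rho> + \<sigma>)))) * z)" for z
  proof -
    let ?r = "- \<i> * complex_of_real (sqrt \<kappa>)"
    let ?z = "\<i> * of_real (sqrt (\<sigma> * (2 * \<rho> + \<sigma>) / (2 * (\<rho> + \<sigma>)))) * z"
    \<comment> \<open>At v = 0 the family consists of the monomials, so the shift from 0 to \<kappa>
      produces the characteristic polynomial.\<close>
    have "hermite2 k z 0 = z ^ k" for k
      by (simp add: hermite2_def fps_exp_sq_def)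
    moreover have "of_real (\<beta> k) = fact N / fact k * fps_exp_sq (complex_of_real \<kappa>) $ (N - k)" for k
      by (simp add: \<beta>_def fps_exp_sq_nth)
    ultimately have P: "hermite2 N z (0 + of_real \<kappa>) = (\<Sum>k\<le>N. of_real (\<beta> k) * z ^ k)"
      by (simp only: hermite2_add)
    have "poly (charac_poly N b) z = (\<Sum>k\<le>N. of_real (\<beta> k) * z ^ k)"
      by (simp add: charac_poly_def poly_sum poly_monom b_\<beta> \<beta>_N flip: lessThan_Suc_atMost)
    \<comment> \<open>The choice of \<open>?r\<close> gives ?r^2 = -\<kappa>, so scaling it out
      leaves the Hermite parameter -1; the two square roots multiply to 1/2.\<close>
    also have "\<dots> = hermite2 N (?r * (2 * ?z)) (?r\<^sup>2 * (- 1))"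
    proof -
      have "\<kappa> * (\<sigma> * (2 * \<rho> + \<sigma>) / (2 * (\<rho> + \<sigma>))) = 1 / 2 * (1 / 2)"
        using assms(1,2) add_pos_pos[of "2 * \<rho>" \<sigma>] by (simp add: \<kappa>_def divide_simps) (simp add: algebra_simps)
      then have "sqrt \<kappa> * sqrt (\<sigma> * (2 * \<rho> + \<sigma>) / (2 * (\<rho> + \<sigma>))) = 1 / 2"
        by (simp only: flip: real_sqrt_mult) (simp add: real_sqrt_divide)
      then have "complex_of_real (sqrt \<kappa>) * of_real (sqrt (\<sigma> * (2 * \<rho> + \<sigma>) / (2 * (\<rho> + \<sigma>)))) = 1 / 2"
        by (metis of_real_mult of_real_1 of_real_divide of_real_numeral)
      then have "?r * (2 * ?z) = z" by (simp add: algebra_simps)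
      moreover have "?r\<^sup>2 * (- 1) = of_real \<kappa>"
        using pos by (simp add: power_mult_distrib flip: of_real_power)
      ultimately show ?thesis using P by simp
    qed
    also have "\<dots> = ?r ^ N * hermite2 N (2 * ?z) (- 1)" by (rule hermite2_scale)
    also have "hermite2 N (2 * ?z) (- 1) = hermite N ?z"
      \<comment> \<open>Scaling by -1 absorbs the sign (-1)^N of Rodrigues' formula.\<close>
      using hermite2_scale[of N "-1" "- 2 * ?z" "-1"]
      by (simp add: hermite_eq_poly rodrigues_poly_eq_hermite2)
    finally show ?thesis .
  qed
  ultimately show ?thesis unfolding \<kappa>_def by blast
qed

end
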